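(* Let $f:\mathbb{C}_0\to\mathbb{C}$ be unbounded, analytic, and almost periodic in $\mathbb{C}_\kappa=\{s=\sigma+it:\sigma>\kappa\}$ for every $\kappa>0$. Call a representation $f=p+b$ a splitting of $f$ if $p$ is unbounded, analytic, and periodic in $\mathbb{C}_\kappa$ for every $\kappa>0$, and $b$ is bounded, analytic, and almost periodic in $\mathbb{C}_\kappa$ for every $\kappa>0$. (a) If $f=p+b$ is a splitting of $f$ and if $t>0$ is the period of the unbounded part of $p$, then the translation module of $f$ (with respect to $\mathbb{C}_\kappa$, for any $\kappa>0$) is \[T_f=\{tk:k\in\mathbb{Z}\}.\] (b) If $f=p_1+b_1$ and $f=p_2+b_2$ are two splittings of $f$, then the unbounded parts of $p_1$ and $p_2$ coincide.
   Context: For real $\kappa$, $\mathbb{C}_\kappa=\{s=\sigma+it:\sigma>\kappa\}$. For real $\tau$, the vertical translation is $V_\tau f(s)=f(s+i\tau)$. A real number $\tau$ is a translation number of $f$ belonging to $\varepsilon>0$ (with respect to $\mathbb{C}_\kappa$) if $|V_\tau f(s)-f(s)|\le\varepsilon$ for all $s\in\mathbb{C}_\kappa$; $E_f(\varepsilon)$ denotes the set of all such $\tau$. The translation module of $f$ with respect to $\mathbb{C}_\kappa$ is $T_f=\bigcup_{\varepsilon>0}E_f(\varepsilon)$. A set of real numbers is relatively dense if there is $L>0$ such that the set has non-empty intersection with every interval of length $L$. A continuous function $f$ on $\mathbb{C}_\kappa$ is almost periodic in $\mathbb{C}_\kappa$ if $E_f(\varepsilon)$ is relatively dense for every $\varepsilon>0$.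 A function $p$ is periodic in $\mathbb{C}_\kappa$ if $V_\tau p=p$ in $\mathbb{C}_\kappa$ for some $\tau>0$; the period of a non-constant periodic (analytic) function $p$ is the smallest $\tau>0$ such that $V_\tau p=p$. A function $p$ that is unbounded, analytic and periodic in $\mathbb{C}_\kappa$ for every $\kappa>0$ can be written as \[p(s)=\sum_{n\in\mathbb{Z}}a_n\exp(-\lambda n s)\] for some $\lambda>0$ (coming from the Laurent series of an analytic function in the punctured unit disc), with absolute convergence at every point of $\mathbb{C}_0$; since $p$ is unbounded in each $\mathbb{C}_\kappa$, there is some $n<0$ with $a_n\ne0$. The unbounded part of $p$ is the function $\sum_{n<0}a_n\exp(-\lambda n s)$. *)

theory Defs
  imports "HOL-Complex_Analysis.Complex_Analysis"
begin

definition right_halfplane :: "real \<Rightarrow> complex set" where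
  "right_halfplane \<kappa> = {s. Re s > \<kappa>}"

definition vtrans :: "real \<Rightarrow> (complex \<Rightarrow> complex) \<Rightarrow> complex \<Rightarrow> complex" where
  "vtrans \<tau> f s = f (s + \<i> * of_real \<tau>)"

definition translation_numbers :: "real \<Rightarrow> (complex \<Rightarrow> complex) \<Rightarrow> real \<Rightarrow> real set" where
  "translation_numbers \<kappa> f \<epsilon> =
     {\<tau>. \<forall>s\<in>right_halfplane \<kappa>. norm (vtrans \<tau> f s - f s) \<le> \<epsilon>}"

definition translation_module :: "real \<Rightarrow> (complex \<Rightarrow> complex) \<Rightarrow> real set" where
  "translation_module \<kappa> f = (\<Union>\<epsilon>\<in>{0<..}. translation_numbers \<kappa> f \<epsilon>)"

definition relatively_dense :: "real set \<Rightarrow> bool" where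
  "relatively_dense S \<longleftrightarrow> (\<exists>L>0. \<forall>x. S \<inter> {x..x + L} \<noteq> {})"

definition almost_periodic_in :: "real \<Rightarrow> (complex \<Rightarrow> complex) \<Rightarrow> bool" where
  "almost_periodic_in \<kappa> f \<longleftrightarrow>
     continuous_on (right_halfplane \<kappa>) f \<and>
     (\<forall>\<epsilon>>0. relatively_dense (translation_numbers \<kappa> f \<epsilon>))"

definition periodic_in :: "real \<Rightarrow> (complex \<Rightarrow> complex) \<Rightarrow> bool" where
  "periodic_in \<kappa> p \<longleftrightarrow> (\<exists>\<tau>>0. \<forall>s\<in>right_halfplane \<kappa>. vtrans \<tau> p s = p s)"

text \<open>A constant function has no smallest positive period, so the following predicate
  holds of no \<open>t\<close> in that case.\<close>

definition is_period_in :: "real \<Rightarrow> (complex \<Rightarrow> complex) \<Rightarrow> real \<Rightarrow> bool" where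
  "is_period_in \<kappa> p t \<longleftrightarrow>
     t > 0 \<and> (\<forall>s\<in>right_halfplane \<kappa>. vtrans t p s = p s) \<and>
     (\<forall>\<tau>>0. (\<forall>s\<in>right_halfplane \<kappa>. vtrans \<tau> p s = p s) \<longrightarrow> t \<le> \<tau>)"

text \<open>Since the terms are complex numbers, \<open>has_sum\<close> amounts to absolute convergence.\<close>

definition exp_expansion :: "(complex \<Rightarrow> complex) \<Rightarrow> real \<Rightarrow> (int \<Rightarrow> complex) \<Rightarrow> bool" where
  "exp_expansion p l a \<longleftrightarrow> l > 0 \<and>
     (\<forall>s\<in>right_halfplane 0.
        ((\<lambda>n. a n * exp (- of_real l * of_int n * s)) has_sum p s) UNIV)"

text \<open>The expansion itself is not unique (\<open>l\<close> may be replaced by \<open>l / m\<close>), but the sum of its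
  terms of negative index is. It is made extensional on the half-plane, so that it is determined
  as a function on the whole type and the description below is definite.\<close>

definition unbounded_part :: "(complex \<Rightarrow> complex) \<Rightarrow> complex \<Rightarrow> complex" where
  "unbounded_part p =
     (THE u. \<exists>l a. exp_expansion p l a \<and>
        u = (\<lambda>s\<in>right_halfplane 0.
               \<Sum>\<^sub>\<infinity>n\<in>{..<0}. a n * exp (- of_real l * of_int n * s)))"

definition is_splitting ::
    "(complex \<Rightarrow> complex) \<Rightarrow> (complex \<Rightarrow> complex) \<Rightarrow> (complex \<Rightarrow> complex) \<Rightarrow> bool" where
  "is_splitting f p b \<longleftrightarrow>
     (\<forall>s\<in>right_halfplane 0. f s = p s + b s) \<and>
     (\<forall>\<kappa>>0. \<not> bounded (p ` right_halfplane \<kappa>) \<and> p analytic_on right_halfplane \<kappa> \<and>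
        periodic_in \<kappa> p) \<and>
     (\<forall>\<kappa>>0. bounded (b ` right_halfplane \<kappa>) \<and> b analytic_on right_halfplane \<kappa> \<and>
        almost_periodic_in \<kappa> b)"

end

theory Submission
  imports Defs
begin

text \<open>
  The unbounded part of \<open>p\<close> has the form \<open>U s = H (exp (l s))\<close> with \<open>H\<close> entire and \<open>H 0 = 0\<close>.
  Convergence of the terms of negative index at points with arbitrarily large real part makes \<open>H\<close>
  entire. Hence \<open>U\<close> extends from the half-plane to an entire function that is bounded on every
  left half-plane and tends to \<open>0\<close> as the real part tends to minus infinity; such functions are
  called \<open>vanishing_left\<close> below, and they are closed under differences and vertical translations.
  The rest of the expansion of \<open>p\<close> is bounded on \<open>right_halfplane \<kappa>\<close> for every \<open>\<kappa> > 0\<close>, so for any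
  splitting \<open>f = p + b\<close> the difference \<open>f - U\<close> is bounded there as well.

  Everything then follows from Liouville's theorem in the form
  \<open>vanishing_left_bounded_right_imp_zero\<close>: a function of this kind that is also bounded on one
  right half-plane is bounded, hence constant, hence zero. If two splittings of \<open>f\<close> give \<open>U\<close> and
  \<open>V\<close>, then \<open>U - V = (f - V) - (f - U)\<close> is bounded on a right half-plane, so \<open>U = V\<close>. The same
  argument shows that the unbounded part does not depend on the expansion used to define it.
  Finally, \<open>\<tau>\<close> lies in the translation module of \<open>f\<close> iff \<open>vtrans \<tau> f - f\<close> is bounded on the
  half-plane, iff \<open>vtrans \<tau> U - U\<close> is bounded there, iff \<open>vtrans \<tau> U = U\<close>. Thus the translation
  module is the group of periods of \<open>U\<close>, and a group of reals with a least positive element consists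
  of the integer multiples of that element.

  That a periodic function has an exponential expansion at all amounts to the Laurent expansion on
  the punctured unit disc around a possibly essential singularity, which is obtained from Cauchy's
  formula for an annulus (\<open>two_circles_Cauchy_formula\<close>) by expanding the kernel geometrically on
  both boundary circles.
\<close>

section \<open>Laurent series on the punctured unit disc\<close>

text \<open>
  The Cauchy kernel \<open>1 / (w - z)\<close> is, up to a factor, a geometric series in \<open>q = z / w\<close>
  when \<open>w\<close> runs over a circle
  outside \<open>z\<close>, and in \<open>q = w / z\<close> when the circle lies inside. Leaving \<open>q\<close> general covers both halves
  of the Laurent series; a uniform bound on \<open>q\<close> below \<open>1\<close> permits integrating term by term, and the
  resulting series converges absolutely.
\<close>

lemma sums_circle_geometric:
  fixes F q :: "complex \<Rightarrow> complex"
  assumes R: "0 < R" and F: "continuous_on (sphere 0 R) F" and q: "continuous_on (sphere 0 R) q"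
    and \<rho>: "\<rho> < 1" "\<And>w. norm w = R \<Longrightarrow> norm (q w) \<le> \<rho>"
  defines "I \<equiv> \<lambda>h. contour_integral (circlepath 0 R) h"
  shows "((\<lambda>n. I (\<lambda>w. F w * q w ^ n)) has_sum I (\<lambda>w. F w / (1 - q w))) UNIV"
proof (rule norm_summable_imp_has_sum)
  have \<rho>0: "0 \<le> \<rho>"
    using order_trans[OF norm_ge_zero \<rho>(2)[of "of_real R"]] R by simp
  have "bounded (F ` sphere 0 R)"
    by (intro compact_imp_bounded compact_continuous_image F) simp
  then obtain B where B: "B > 0" "\<And>w. norm w = R \<Longrightarrow> norm (F w) \<le> B"
    unfolding bounded_pos by auto
  have le: "norm (F w * q w ^ n) \<le> B * \<rho> ^ n" if "norm w = R" for w n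
    unfolding norm_mult norm_power using that B \<rho> \<rho>0
    by (intro mult_mono power_mono) auto
  have int: "(\<lambda>w. F w * q w ^ n) contour_integrable_on circlepath 0 R" for n
    by (intro contour_integrable_continuous_circlepath continuous_intros)
       (use R F q in auto)
  have geo: "summable (\<lambda>n. B * \<rho> ^ n)"
    using \<rho> \<rho>0 by (intro summable_mult summable_geometric) auto
  show "summable (\<lambda>n. norm (I (\<lambda>w. F w * q w ^ n)))"
  proof (rule summable_comparison_test')
    show "summable (\<lambda>n. B * \<rho> ^ n * (2 * pi * R))"
      using geo by (rule summable_mult2)
    show "norm (norm (I (\<lambda>w. F w * q w ^ n))) \<le> B * \<rho> ^ n * (2 * pi * R)" for n
      unfolding real_norm_def abs_norm_cancel I_def
      by (rule has_contour_integral_bound_circlepath[OF has_contour_integral_integral[OF int]])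
         (use R B \<rho>0 le in auto)
  qed
  have lim: "uniform_limit (sphere 0 R) (\<lambda>N w. \<Sum>n<N. F w * q w ^ n)
               (\<lambda>w. \<Sum>n. F w * q w ^ n) sequentially"
    by (rule Weierstrass_m_test[OF le geo]) simp
  have "(\<Sum>n. F w * q w ^ n) = F w / (1 - q w)" if "norm w = R" for w
  proof -
    have "norm (q w) < 1" using \<rho> that by force
    then have "(\<lambda>n. F w * q w ^ n) sums (F w * (1 / (1 - q w)))"
      by (intro sums_mult geometric_sums)
    then show ?thesis by (simp add: sums_iff)
  qed
  with lim have lim: "uniform_limit (sphere 0 R) (\<lambda>N w. \<Sum>n<N. F w * q w ^ n)
                   (\<lambda>w. F w / (1 - q w)) sequentially"
    by (subst (asm) uniform_limit_cong') auto
  have "(\<lambda>N. I (\<lambda>w. \<Sum>n<N. F w * q w ^ n)) \<longlonglongrightarrow> I (\<lambda>w. F w / (1 - q w))"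
    unfolding I_def
    by (rule contour_integral_uniform_limit_circlepath(2)[OF always_eventually lim])
       (use R int in \<open>auto intro!: contour_integrable_sum\<close>)
  then show "(\<lambda>n. I (\<lambda>w. F w * q w ^ n)) sums I (\<lambda>w. F w / (1 - q w))"
    unfolding sums_def I_def using int by (simp add: contour_integral_sum)
qed

lemma residue_circle_punctured_disc:
  assumes "h holomorphic_on ball 0 1 - {0}" "0 < r" "r < 1"
  shows "contour_integral (circlepath 0 r) h = 2 * pi * \<i> * residue h 0"
  by (rule contour_integral_unique, rule base_residue[of "ball 0 1"]) (use assms in auto)

text \<open>
  The integrand has the singularities \<open>0\<close> and \<open>z\<close>. The outer circle sees both residues, the inner
  one only the residue at \<open>0\<close>, which therefore cancels even when this singularity is essential.
\<close>

lemma two_circles_Cauchy_formula: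
  assumes g: "g holomorphic_on ball 0 1 - {0}" and rR: "0 < r" "r < norm z" "norm z < R" "R < 1"
  shows "contour_integral (circlepath 0 R) (\<lambda>w. g w / (w - z))
       - contour_integral (circlepath 0 r) (\<lambda>w. g w / (w - z)) = 2 * pi * \<i> * g z"
proof -
  have z: "z \<noteq> 0" using rR by auto
  have hol: "(\<lambda>w. g w / (w - z)) holomorphic_on ball 0 1 - {0, z}"
    by (intro holomorphic_intros holomorphic_on_subset[OF g]) auto
  have "contour_integral (circlepath 0 R) (\<lambda>w. g w / (w - z)) =
        2 * pi * \<i> * (\<Sum>p\<in>{0, z}. winding_number (circlepath 0 R) p * residue (\<lambda>w. g w / (w - z)) p)"
  proof (rule Residue_theorem[of "ball 0 1"])
    show "\<forall>w. w \<notin> ball 0 1 \<longrightarrow> winding_number (circlepath 0 R) w = 0"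
      using rR by (auto intro!: winding_number_zero_outside[of _ "cball 0 R"])
  qed (use rR z hol in \<open>auto simp: path_image_circlepath\<close>)
  also have "\<dots> = 2 * pi * \<i> * (residue (\<lambda>w. g w / (w - z)) 0 + residue (\<lambda>w. g w / (w - z)) z)"
    using rR z by (simp add: winding_number_circlepath)
  also have "residue (\<lambda>w. g w / (w - z)) z = g z"
    by (rule residue_simple[of "ball 0 1 - {0}"]) (use g rR z in auto)
  finally have 1: "contour_integral (circlepath 0 R) (\<lambda>w. g w / (w - z)) =
      2 * pi * \<i> * (residue (\<lambda>w. g w / (w - z)) 0 + g z)" .
  have "contour_integral (circlepath 0 r) (\<lambda>w. g w / (w - z)) =
      2 * pi * \<i> * residue (\<lambda>w. g w / (w - z)) 0"
    by (rule contour_integral_unique, rule base_residue[of "ball 0 (norm z)"])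
       (use rR in \<open>auto intro!: holomorphic_on_subset[OF hol]\<close>)
  with 1 show ?thesis by (simp add: algebra_simps)
qed

text \<open>
  Taking residues as coefficients makes them visibly independent of \<open>z\<close>, although the circles used
  in the proof depend on \<open>z\<close>: the integral of \<open>g w * w powi (- n - 1)\<close> over any circle around \<open>0\<close>
  gives the same residue.
\<close>

theorem Laurent_series_punctured_disc:
  assumes g: "g holomorphic_on ball 0 1 - {0}" and z: "z \<in> ball 0 1 - {0}"
  shows "((\<lambda>n. residue (\<lambda>w. g w * w powi (- n - 1)) 0 * z powi n) has_sum g z) UNIV"
    (is "(?t has_sum _) _")
proof -
  define r R where "r = norm z / 2" and "R = (norm z + 1) / 2"
  have rR: "0 < r" "r < norm z" "norm z < R" "R < 1"
    using z by (auto simp: r_def R_def)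
  define c where "c = 2 * pi * \<i>"
  have c: "c \<noteq> 0" by (simp add: c_def)
  have cont: "continuous_on (sphere 0 \<rho>) g" if "0 < \<rho>" "\<rho> < 1" for \<rho>
    using that by (intro continuous_on_subset[OF holomorphic_on_imp_continuous_on[OF g]]) auto
  have coeff: "contour_integral (circlepath 0 \<rho>) (\<lambda>w. g w * w powi (- n - 1)) * z powi n = c * ?t n"
    if "0 < \<rho>" "\<rho> < 1" for \<rho> n
    using that by (subst residue_circle_punctured_disc)
       (auto intro!: holomorphic_intros g simp: c_def)
  have term_eq: "contour_integral (circlepath 0 \<rho>) (\<lambda>w. h w * z powi n) = c * ?t n"
    if "0 < \<rho>" "\<rho> < 1" and h: "\<And>w. norm w = \<rho> \<Longrightarrow> h w = g w * w powi (- n - 1)" for \<rho> n h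
  proof -
    have "contour_integral (circlepath 0 \<rho>) (\<lambda>w. h w * z powi n) =
          contour_integral (circlepath 0 \<rho>) (\<lambda>w. z powi n * (g w * w powi (- n - 1)))"
      using that by (intro contour_integral_eq) (auto simp: path_image_circlepath)
    also have "\<dots> = z powi n * contour_integral (circlepath 0 \<rho>) (\<lambda>w. g w * w powi (- n - 1))"
      using that by (intro contour_integral_lmul contour_integrable_continuous_circlepath
          continuous_intros continuous_on_subset[OF cont]) (auto simp: path_image_circlepath)
    finally show ?thesis using coeff that(1,2) by (simp add: mult.commute)
  qed
  have z0: "z \<noteq> 0" using z by auto

  have outer: "((\<lambda>n::nat. c * ?t (int n)) has_sum
      contour_integral (circlepath 0 R) (\<lambda>w. g w / (w - z))) UNIV"
  proof -
    have "((\<lambda>n. contour_integral (circlepath 0 R) (\<lambda>w. g w / w * (z / w) ^ n)) has_sum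
      contour_integral (circlepath 0 R) (\<lambda>w. g w / w / (1 - z / w))) UNIV"
      by (rule sums_circle_geometric[where \<rho> = "norm z / R"])
         (use rR in \<open>auto intro!: continuous_intros cont simp: norm_divide\<close>)
    also have "contour_integral (circlepath 0 R) (\<lambda>w. g w / w / (1 - z / w)) =
        contour_integral (circlepath 0 R) (\<lambda>w. g w / (w - z))"
      by (rule contour_integral_eq)
         (use rR in \<open>auto simp: path_image_circlepath field_simps\<close>)
    also have "(\<lambda>n. contour_integral (circlepath 0 R) (\<lambda>w. g w / w * (z / w) ^ n)) =
        (\<lambda>n. c * ?t (int n))"
    proof
      fix n :: nat
      have "contour_integral (circlepath 0 R) (\<lambda>w. g w / w * (z / w) ^ n) =
         contour_integral (circlepath 0 R) (\<lambda>w. (g w / w / w ^ n) * z powi int n)"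
        by (simp add: power_divide)
      also have "\<dots> = c * ?t (int n)"
        using rR by (intro term_eq) (auto simp: power_int_diff power_int_minus field_simps)
      finally show "contour_integral (circlepath 0 R) (\<lambda>w. g w / w * (z / w) ^ n) = c * ?t (int n)" .
    qed
    finally show ?thesis .
  qed

  have inner: "((\<lambda>n::nat. c * ?t (- int n - 1)) has_sum
      - contour_integral (circlepath 0 r) (\<lambda>w. g w / (w - z))) UNIV"
  proof -
    have "((\<lambda>n. contour_integral (circlepath 0 r) (\<lambda>w. g w / z * (w / z) ^ n)) has_sum
      contour_integral (circlepath 0 r) (\<lambda>w. g w / z / (1 - w / z))) UNIV"
      by (rule sums_circle_geometric[where \<rho> = "r / norm z"])
         (use rR z0 in \<open>auto intro!: continuous_intros cont simp: norm_divide\<close>)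
    also have "contour_integral (circlepath 0 r) (\<lambda>w. g w / z / (1 - w / z)) =
        contour_integral (circlepath 0 r) (\<lambda>w. - (g w / (w - z)))"
      by (rule contour_integral_eq)
         (use rR z0 in \<open>auto simp: path_image_circlepath field_simps minus_divide_right\<close>)
    also have "\<dots> = - contour_integral (circlepath 0 r) (\<lambda>w. g w / (w - z))"
      by (rule contour_integral_neg)
    also have "(\<lambda>n. contour_integral (circlepath 0 r) (\<lambda>w. g w / z * (w / z) ^ n)) =
        (\<lambda>n. c * ?t (- int n - 1))"
    proof
      fix n :: nat
      have "contour_integral (circlepath 0 r) (\<lambda>w. g w / z * (w / z) ^ n) =
         contour_integral (circlepath 0 r) (\<lambda>w. (g w * w ^ n) * z powi (- int n - 1))"
        using z0 by (simp add: power_int_diff power_int_minus field_simps)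
      also have "\<dots> = c * ?t (- int n - 1)"
        using rR by (intro term_eq) auto
      finally show "contour_integral (circlepath 0 r) (\<lambda>w. g w / z * (w / z) ^ n) =
          c * ?t (- int n - 1)" .
    qed
    finally show ?thesis .
  qed

  have "((\<lambda>n. c * ?t n) has_sum contour_integral (circlepath 0 R) (\<lambda>w. g w / (w - z))) {0..}"
    by (rule has_sum_reindex_bij_witness[where i = nat and j = int, THEN iffD1, OF _ _ _ _ _ _ outer]) auto
  moreover have "((\<lambda>n. c * ?t n) has_sum - contour_integral (circlepath 0 r) (\<lambda>w. g w / (w - z))) {..<0}"
    by (rule has_sum_reindex_bij_witness[where i = "\<lambda>k. nat (- k - 1)" and
          j = "\<lambda>n. - int n - 1", THEN iffD1, OF _ _ _ _ _ _ inner]) auto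
  ultimately have "((\<lambda>n. c * ?t n) has_sum c * g z) ({0..} \<union> {..<0})"
    using has_sum_Un_disjoint[of "\<lambda>n. c * ?t n" "{0..}" _ "{..<0}"]
          two_circles_Cauchy_formula[OF g rR] by (force simp: c_def)
  also have "{0..} \<union> {..<0} = (UNIV :: int set)"
    by auto
  finally have "((\<lambda>n. inverse c * (c * ?t n)) has_sum inverse c * (c * g z)) UNIV"
    by (rule has_sum_cmult_right)
  then show ?thesis using c by (simp add: mult.assoc[symmetric])
qed

section \<open>Exponential expansions of periodic functions\<close>

lemma open_right_halfplane: "open (right_halfplane \<kappa>)"
  by (simp add: right_halfplane_def open_halfspace_Re_gt)

lemma connected_right_halfplane: "connected (right_halfplane \<kappa>)"
  by (simp add: right_halfplane_def convex_halfspace_Re_gt convex_connected)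

lemma right_halfplane_vtrans_iff [simp]:
  "s + \<i> * of_real \<tau> \<in> right_halfplane \<kappa> \<longleftrightarrow> s \<in> right_halfplane \<kappa>"
  by (simp add: right_halfplane_def)

text \<open>
  By the identity theorem a period in one half-plane is a period in any larger one on which
  the function is holomorphic, so a single period serves all the half-planes at once.
\<close>

lemma vtrans_period_extends:
  assumes p: "p holomorphic_on right_halfplane 0" and \<kappa>: "0 < \<kappa>"
    and per: "\<And>s. s \<in> right_halfplane \<kappa> \<Longrightarrow> vtrans \<tau> p s = p s"
    and s: "s \<in> right_halfplane 0"
  shows "vtrans \<tau> p s = p s"
proof (rule analytic_continuation_open[of "right_halfplane \<kappa>" "right_halfplane 0" "vtrans \<tau> p" p])
  show "vtrans \<tau> p holomorphic_on right_halfplane 0"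
    unfolding vtrans_def
    by (rule holomorphic_on_compose_gen[OF _ p, unfolded o_def])
       (auto intro!: holomorphic_intros)
  show "right_halfplane \<kappa> \<noteq> {}"
    by (auto simp: right_halfplane_def intro!: exI[of _ "of_real (\<kappa> + 1)"])
  show "right_halfplane \<kappa> \<subseteq> right_halfplane 0"
    using \<kappa> by (auto simp: right_halfplane_def)
qed (use assms in \<open>auto simp: open_right_halfplane connected_right_halfplane\<close>)

lemma vtrans_period_int_multiple:
  assumes per: "\<And>s. s \<in> right_halfplane \<kappa> \<Longrightarrow> vtrans \<tau> p s = p s"
    and s: "s \<in> right_halfplane \<kappa>"
  shows "vtrans (\<tau> * of_int k) p s = p s"
  using s
proof (induction k arbitrary: s rule: int_induct[of _ 0])
  case base
  then show ?case by (simp add: vtrans_def)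
next
  case (step1 k)
  then have "vtrans \<tau> p (s + \<i> * of_real (\<tau> * of_int k)) = p (s + \<i> * of_real (\<tau> * of_int k))"
    by (intro per) (simp only: right_halfplane_vtrans_iff)
  with step1 show ?case
    by (simp add: vtrans_def algebra_simps)
next
  case (step2 k)
  then have "vtrans \<tau> p (s + \<i> * of_real (\<tau> * of_int (k - 1))) = p (s + \<i> * of_real (\<tau> * of_int (k - 1)))"
    by (intro per) (simp only: right_halfplane_vtrans_iff)
  with step2 show ?case
    by (simp add: vtrans_def algebra_simps)
qed

text \<open>
  With \<open>l = 2 pi / \<tau>\<close>, periodicity lets \<open>p\<close> descend along \<open>s \<mapsto> exp (- l s)\<close>, which maps the
  half-plane onto the punctured unit disc; the expansion is the Laurent series of the resulting
  function.
\<close>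

theorem periodic_has_exp_expansion:
  assumes p: "p holomorphic_on right_halfplane 0" and per: "periodic_in \<kappa> p" "0 < \<kappa>"
  shows "\<exists>l a. exp_expansion p l a"
proof -
  obtain \<tau> where \<tau>: "\<tau> > 0" "\<And>s. s \<in> right_halfplane \<kappa> \<Longrightarrow> vtrans \<tau> p s = p s"
    using per unfolding periodic_in_def by blast
  have per0: "p (s + \<i> * of_real (\<tau> * of_int k)) = p s" if "s \<in> right_halfplane 0" for s k
    using vtrans_period_int_multiple[of 0 \<tau> p s k] vtrans_period_extends[OF p \<open>0 < \<kappa>\<close> \<tau>(2)] that
    by (simp add: vtrans_def)
  define l where "l = 2 * pi / \<tau>"
  have l: "l > 0" using \<tau> by (simp add: l_def)
  have l\<tau>: "l * \<tau> = 2 * pi" using \<tau> by (simp add: l_def)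
  define g where "g z = p (- Ln z / of_real l)" for z
  have eq: "p s = p s'" if e: "exp (- of_real l * s) = exp (- of_real l * s')" and s: "s \<in> right_halfplane 0" for s s'
  proof -
    obtain n :: int where n: "- of_real l * s' = - of_real l * s + (of_int (2 * n) * pi) * \<i>"
      using iffD1[OF exp_eq e[symmetric]] by blast
    have neg: "X = Y - Z" if "- X = - Y + Z" for X Y Z :: complex
      using that by (metis add_uminus_conv_diff minus_add_distrib minus_minus)
    have "of_real l * s' = of_real l * s - (of_int (2 * n) * pi) * \<i>"
      using n by (intro neg) (simp only: mult_minus_left)
    also have "of_int (2 * n) * pi = of_int n * (l * \<tau>)"
      by (simp add: l\<tau>)
    also have "of_real l * s - of_real (of_int n * (l * \<tau>)) * \<i> = of_real l * (s + \<i> * of_real (\<tau> * of_int (- n)))"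
      by (simp add: algebra_simps)
    finally have "of_real l * s' = of_real l * (s + \<i> * of_real (\<tau> * of_int (- n)))" .
    then have "s' = s + \<i> * of_real (\<tau> * of_int (- n))" using l by simp
    then show ?thesis using per0[OF s, of "- n"] by simp
  qed
  have Ln_mem: "- Ln z / of_real l \<in> right_halfplane 0" if "z \<in> ball 0 1 - {0}" for z
    using that l by (auto simp: right_halfplane_def field_simps)
  have g_eq: "g z = p s" if "exp (- of_real l * s) = z" "s \<in> right_halfplane 0" for z s
    unfolding g_def
  proof (rule eq[symmetric])
    show "exp (- of_real l * s) = exp (- of_real l * (- Ln z / of_real l))"
      using that l by auto
  qed (use that in auto)
  have "g holomorphic_on ball 0 1 - {0} - \<real>\<^sub>\<le>\<^sub>0"
    unfolding g_def
  proof (rule holomorphic_on_compose_gen[OF _ p, unfolded o_def])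
    show "(\<lambda>z. - Ln z / of_real l) holomorphic_on ball 0 1 - {0} - \<real>\<^sub>\<le>\<^sub>0"
      using l by (auto intro!: holomorphic_intros)
    show "(\<lambda>z. - Ln z / of_real l) ` (ball 0 1 - {0} - \<real>\<^sub>\<le>\<^sub>0) \<subseteq> right_halfplane 0"
      using Ln_mem by blast
  qed
  \<comment> \<open>Near the cut of \<open>Ln\<close> another branch of the logarithm is used; by periodicity it gives
     the same function \<open>g\<close>.\<close>
  moreover have "g holomorphic_on ball 0 1 - {0} - {z. - z \<in> \<real>\<^sub>\<le>\<^sub>0}"
  proof -
    have "(\<lambda>z. p ((- Ln (- z) - \<i> * pi) / of_real l)) holomorphic_on ball 0 1 - {0} - {z. - z \<in> \<real>\<^sub>\<le>\<^sub>0}"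
      by (rule holomorphic_on_compose_gen[OF _ p, unfolded o_def])
         (use l in \<open>auto intro!: holomorphic_intros simp: right_halfplane_def field_simps\<close>)
    moreover have "g z = p ((- Ln (- z) - \<i> * pi) / of_real l)" if "z \<in> ball 0 1 - {0}" for z
    proof (rule g_eq)
      have "- of_real l * ((- Ln (- z) - \<i> * pi) / of_real l) = Ln (- z) + \<i> * pi"
        using l by (simp add: field_simps)
      then show "exp (- of_real l * ((- Ln (- z) - \<i> * pi) / of_real l)) = z"
        using that by (simp only: exp_add) simp
      show "(- Ln (- z) - \<i> * pi) / of_real l \<in> right_halfplane 0"
        using l that by (simp add: right_halfplane_def field_simps)
    qed
    ultimately show ?thesis
      by (subst holomorphic_cong[OF refl]) auto
  qed
  moreover have "open (ball 0 1 - {0} - \<real>\<^sub>\<le>\<^sub>0 :: complex set)"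
    by (intro open_Diff closed_nonpos_Reals_complex) auto
  moreover have "open (ball 0 1 - {0} - {z :: complex. - z \<in> \<real>\<^sub>\<le>\<^sub>0})"
    by (intro open_Diff closed_vimage[of "\<real>\<^sub>\<le>\<^sub>0" uminus, unfolded vimage_def] 
         closed_nonpos_Reals_complex continuous_intros) auto
  ultimately have "g holomorphic_on (ball 0 1 - {0} - \<real>\<^sub>\<le>\<^sub>0) \<union> (ball 0 1 - {0} - {z. - z \<in> \<real>\<^sub>\<le>\<^sub>0})"
    by (rule holomorphic_on_Un)
  also have "(ball 0 1 - {0} - \<real>\<^sub>\<le>\<^sub>0) \<union> (ball 0 1 - {0} - {z. - z \<in> \<real>\<^sub>\<le>\<^sub>0}) = (ball 0 1 - {0} :: complex set)"
    by (auto simp: complex_nonpos_Reals_iff complex_eq_iff)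
  finally have g: "g holomorphic_on ball 0 1 - {0}" .
  define a where "a n = residue (\<lambda>w. g w * w powi (- n - 1)) 0" for n
  have "exp_expansion p l a"
    unfolding exp_expansion_def
  proof (intro conjI ballI l)
    fix s assume s: "s \<in> right_halfplane 0"
    have "((\<lambda>n. a n * exp (- of_real l * s) powi n) has_sum g (exp (- of_real l * s))) UNIV"
      unfolding a_def by (rule Laurent_series_punctured_disc[OF g])
        (use s l in \<open>auto simp: right_halfplane_def\<close>)
    then show "((\<lambda>n. a n * exp (- of_real l * of_int n * s)) has_sum p s) UNIV"
      using g_eq[OF refl s] by (simp add: exp_power_int mult_ac)
  qed
  then show ?thesis by blast
qed

section \<open>Entire functions that vanish far to the left\<close>

text \<open>
  These are the properties of the unbounded part that its uniqueness rests on. They mention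
  neither the series nor the rate \<open>l\<close>, so that functions with different periods can be compared.
  The filter expresses that the limit is uniform in the imaginary part.
\<close>

definition vanishing_left :: "(complex \<Rightarrow> complex) \<Rightarrow> bool" where
  "vanishing_left U \<longleftrightarrow> U holomorphic_on UNIV \<and> (\<forall>\<kappa>. bounded (U ` {s. Re s \<le> \<kappa>})) \<and>
     (U \<longlongrightarrow> 0) (filtercomap Re at_bot)"

lemma vanishing_left_diff:
  assumes "vanishing_left U" "vanishing_left V"
  shows "vanishing_left (\<lambda>s. U s - V s)"
  using assms tendsto_diff[of U 0 _ V 0]
  by (auto simp: vanishing_left_def intro!: holomorphic_intros bounded_minus_comp)

lemma vanishing_left_vtrans:
  assumes "vanishing_left U"
  shows "vanishing_left (vtrans \<tau> U)"
  unfolding vanishing_left_def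
proof (intro conjI allI)
  have U: "U holomorphic_on UNIV" "\<And>\<kappa>. bounded (U ` {s. Re s \<le> \<kappa>})"
     "(U \<longlongrightarrow> 0) (filtercomap Re at_bot)"
    using assms by (auto simp: vanishing_left_def)
  show "vtrans \<tau> U holomorphic_on UNIV"
    unfolding vtrans_def
    by (rule holomorphic_on_compose_gen[OF _ U(1), unfolded o_def])
       (auto intro!: holomorphic_intros)
  show "bounded (vtrans \<tau> U ` {s. Re s \<le> \<kappa>})" for \<kappa>
    by (rule bounded_subset[OF U(2)[of \<kappa>]]) (auto simp: vtrans_def)
  have "filterlim (\<lambda>s. s + \<i> * of_real \<tau>) (filtercomap Re at_bot) (filtercomap Re at_bot)"
    by (simp add: filterlim_filtercomap_iff o_def filterlim_filtercomap)
  then show "(vtrans \<tau> U \<longlongrightarrow> 0) (filtercomap Re at_bot)"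
    unfolding vtrans_def by (rule filterlim_compose[OF U(3)])
qed

lemma vanishing_left_bounded_right_imp_zero:
  assumes U: "vanishing_left U" and bdd: "bounded (U ` right_halfplane \<kappa>)"
  shows "U s = 0"
proof -
  have "range U = U ` {s. Re s \<le> \<kappa>} \<union> U ` right_halfplane \<kappa>"
    unfolding image_Un[symmetric] by (rule arg_cong[of _ _ "image U"]) (auto simp: right_halfplane_def)
  then have "bounded (range U)"
    using U bdd by (simp add: vanishing_left_def)
  then obtain K where K: "U = (\<lambda>_. K)"
    using Liouville_theorem[of U] U by (auto simp: vanishing_left_def constant_on_def)
  have "(U \<longlongrightarrow> K) (filtercomap Re at_bot)"
    by (simp add: K)
  moreover have "(U \<longlongrightarrow> 0) (filtercomap Re at_bot)"
    using U by (simp add: vanishing_left_def)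
  moreover have "filtercomap Re at_bot \<noteq> bot"
    by (intro filtercomap_neq_bot_surj surjI[of Re of_real]) auto
  ultimately have "K = 0"
    by (metis tendsto_unique)
  then show ?thesis by (simp add: K)
qed

lemma vanishing_left_part_unique:
  assumes "vanishing_left U" "bounded ((\<lambda>s. h s - U s) ` right_halfplane \<kappa>)"
    and "vanishing_left V" "bounded ((\<lambda>s. h s - V s) ` right_halfplane \<kappa>)"
  shows "U s = V s"
proof -
  have "bounded ((\<lambda>s. (h s - V s) - (h s - U s)) ` right_halfplane \<kappa>)"
    by (intro bounded_minus_comp assms)
  then have "bounded ((\<lambda>s. U s - V s) ` right_halfplane \<kappa>)"
    by simp
  then show ?thesis
    using vanishing_left_bounded_right_imp_zero[OF vanishing_left_diff[OF assms(1,3)]] by simp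
qed

text \<open>
  Needed because periods of the unbounded part are given on a right half-plane only, whereas the
  comparison of translation differences concerns the whole plane.
\<close>

lemma vanishing_left_period_extends:
  assumes U: "vanishing_left U" and "\<And>s. s \<in> right_halfplane \<kappa> \<Longrightarrow> vtrans \<tau> U s = U s"
  shows "vtrans \<tau> U s = U s"
proof -
  have "(\<lambda>s. vtrans \<tau> U s - U s) ` right_halfplane \<kappa> \<subseteq> {0}"
    using assms(2) by auto
  then have "bounded ((\<lambda>s. vtrans \<tau> U s - U s) ` right_halfplane \<kappa>)"
    by (rule bounded_subset[rotated]) simp
  from vanishing_left_bounded_right_imp_zero[OF vanishing_left_diff[OF vanishing_left_vtrans[OF U] U] this]
  show ?thesis by simp
qed

section \<open>The unbounded part\<close>

text \<open>
  In the variable \<open>w = exp (l s)\<close> the terms of negative index form a power series without constant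
  term. It converges at every \<open>w\<close> with modulus above \<open>1\<close>, hence everywhere, so its sum is entire in
  \<open>w\<close> and vanishes at \<open>w = 0\<close>, the limit of \<open>exp (l s)\<close> at the far left.
\<close>

lemma exp_expansion_negative_part:
  assumes "exp_expansion p l a"
  obtains U where "vanishing_left U"
    and "\<And>s. s \<in> right_halfplane 0 \<Longrightarrow>
           ((\<lambda>n. a n * exp (- of_real l * of_int n * s)) has_sum U s) {..<0}"
proof -
  from assms have l: "l > 0" and exps: "\<And>s. s \<in> right_halfplane 0 \<Longrightarrow>
      ((\<lambda>n. a n * exp (- of_real l * of_int n * s)) has_sum p s) UNIV"
    by (auto simp: exp_expansion_def)
  define c where "c m = (if m = 0 then 0 else a (- int m))" for m
  define N where "N s = (\<Sum>\<^sub>\<infinity>n\<in>{..<0}. a n * exp (- of_real l * of_int n * s))" for s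
  have N: "((\<lambda>n. a n * exp (- of_real l * of_int n * s)) has_sum N s) {..<0}"
    if "s \<in> right_halfplane 0" for s
    unfolding N_def
    by (rule has_sum_infsum[OF summable_on_subset_banach[OF has_sum_imp_summable[OF exps[OF that]]]]) simp
  have sums: "(\<lambda>m. c m * exp (of_real l * s) ^ m) sums N s" if "s \<in> right_halfplane 0" for s
  proof -
    have "((\<lambda>m. c m * exp (of_real l * s) ^ m) has_sum N s) {0<..}"
    proof (rule has_sum_reindex_bij_witness[where i = "\<lambda>m. - int m" and j = "\<lambda>n. nat (- n)",
          THEN iffD1, OF _ _ _ _ _ _ N[OF that]])
      fix n :: int assume n: "n \<in> {..<0}"
      have "exp (of_real l * s) ^ nat (- n) = exp (of_nat (nat (- n)) * (of_real l * s))"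
        by (simp only: exp_of_nat_mult)
      also have "of_nat (nat (- n)) = (- of_int n :: complex)"
        using n by simp
      finally show "c (nat (- n)) * exp (of_real l * s) ^ nat (- n) =
          a n * exp (- of_real l * of_int n * s)"
        using n by (simp add: c_def mult_ac)
    qed auto
    also have "?this \<longleftrightarrow> ((\<lambda>m. c m * exp (of_real l * s) ^ m) has_sum N s) UNIV"
      by (rule has_sum_cong_neutral) (auto simp: c_def)
    finally show ?thesis by (rule has_sum_imp_sums)
  qed
  define H where "H = Abs_fps c"
  have "conv_radius c = \<infinity>"
  proof (rule conv_radius_inftyI'[of 1])
    fix r :: real assume r: "r > 1"
    have "of_real (ln r / l) \<in> right_halfplane 0"
      using r l by (simp add: right_halfplane_def)
    from sums[OF this] have "summable (\<lambda>m. c m * exp (of_real (ln r)) ^ m)"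
      using l by (simp add: sums_iff)
    moreover have "exp (of_real (ln r)) = complex_of_real r"
      using r by (simp add: exp_of_real)
    ultimately show "\<exists>z. norm z = r \<and> summable (\<lambda>m. c m * z ^ m)"
      using r by (intro exI[of _ "of_real r"]) auto
  qed
  then have rad: "fps_conv_radius H = \<infinity>"
    by (simp add: H_def fps_conv_radius_def)
  have hol: "eval_fps H holomorphic_on S" for S
    by (rule holomorphic_on_eval_fps) (simp add: rad)
  define U where "U s = eval_fps H (exp (of_real l * s))" for s
  have "vanishing_left U"
    unfolding vanishing_left_def
  proof (intro conjI allI)
    show "U holomorphic_on UNIV"
      unfolding U_def
      by (rule holomorphic_on_compose_gen[OF _ hol[of UNIV], unfolded o_def])
         (auto intro!: holomorphic_intros)
    fix \<kappa>
    have "bounded (eval_fps H ` cball 0 (exp (l * \<kappa>)))"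
      by (intro compact_imp_bounded compact_continuous_image holomorphic_on_imp_continuous_on hol) auto
    then show "bounded (U ` {s. Re s \<le> \<kappa>})"
      by (rule bounded_subset) (use l in \<open>auto simp: U_def\<close>)
  next
    have "((\<lambda>x. exp (l * x)) \<longlongrightarrow> 0) at_bot"
      by (rule filterlim_compose[OF exp_at_bot filterlim_tendsto_pos_mult_at_bot[OF tendsto_const l filterlim_ident]])
    then have "((\<lambda>s. exp (l * Re s)) \<longlongrightarrow> 0) (filtercomap Re at_bot)"
      by (rule filterlim_compose[OF _ filterlim_filtercomap])
    then have "((\<lambda>s. exp (of_real l * s)) \<longlongrightarrow> 0) (filtercomap Re at_bot)"
      by (intro tendsto_norm_zero_cancel[of "\<lambda>s. exp (of_real l * s)"]) simp
    moreover have "isCont (eval_fps H) 0"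
      using holomorphic_on_imp_continuous_on[OF hol[of UNIV]] by (simp add: continuous_on_eq_continuous_at)
    ultimately have "(U \<longlongrightarrow> eval_fps H 0) (filtercomap Re at_bot)"
      unfolding U_def by (intro isCont_tendsto_compose[of 0 "eval_fps H"])
    then show "(U \<longlongrightarrow> 0) (filtercomap Re at_bot)"
      by (simp add: eval_fps_at_0 H_def c_def)
  qed
  moreover have "((\<lambda>n. a n * exp (- of_real l * of_int n * s)) has_sum U s) {..<0}"
    if "s \<in> right_halfplane 0" for s
    using N[OF that] sums[OF that] by (simp add: U_def H_def eval_fps_def sums_iff)
  ultimately show ?thesis
    by (rule that)
qed

text \<open>
  The modulus of a term of nonnegative index does not increase with the real part, so the absolute sum at
  the boundary point \<open>\<kappa>\<close> dominates the whole half-plane.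
\<close>

lemma exp_expansion_minus_negative_part_bounded:
  assumes "exp_expansion p l a" and \<kappa>: "0 < \<kappa>"
    and U: "\<And>s. s \<in> right_halfplane 0 \<Longrightarrow>
           ((\<lambda>n. a n * exp (- of_real l * of_int n * s)) has_sum U s) {..<0}"
  shows "bounded ((\<lambda>s. p s - U s) ` right_halfplane \<kappa>)"
proof -
  from assms(1) have l: "l > 0" and exps: "\<And>s. s \<in> right_halfplane 0 \<Longrightarrow>
      ((\<lambda>n. a n * exp (- of_real l * of_int n * s)) has_sum p s) UNIV"
    by (auto simp: exp_expansion_def)
  have sum_nonneg: "((\<lambda>n. a n * exp (- of_real l * of_int n * s)) has_sum p s - U s) {0..}"
    if "s \<in> right_halfplane 0" for s
  proof -
    have "((\<lambda>n. a n * exp (- of_real l * of_int n * s)) has_sum p s - U s) (UNIV - {..<0})"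
      by (intro has_sum_Diff exps U that) auto
    also have "UNIV - {..<0} = {0::int..}" by auto
    finally show ?thesis .
  qed
  define M where "M = (\<Sum>\<^sub>\<infinity>n\<in>{0..}. norm (a n * exp (- of_real l * of_int n * of_real \<kappa>)))"
  have "(\<lambda>n. a n * exp (- of_real l * of_int n * of_real \<kappa>)) summable_on {0..}"
    using sum_nonneg[of "of_real \<kappa>"] \<kappa> by (auto simp: right_halfplane_def summable_on_def)
  then have M: "((\<lambda>n. norm (a n * exp (- of_real l * of_int n * of_real \<kappa>))) has_sum M) {0..}"
    unfolding M_def by (intro has_sum_infsum) (simp only: summable_on_iff_abs_summable_on_complex)
  have "norm (p s - U s) \<le> M" if "s \<in> right_halfplane \<kappa>" for s
  proof (rule norm_infsum_le[OF sum_nonneg M])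
    show "s \<in> right_halfplane 0" using that \<kappa> by (simp add: right_halfplane_def)
    fix n :: int assume "n \<in> {0..}"
    then have "l * of_int n * \<kappa> \<le> l * of_int n * Re s"
      using that l by (intro mult_left_mono) (auto simp: right_halfplane_def)
    then show "norm (a n * exp (- of_real l * of_int n * s))
        \<le> norm (a n * exp (- of_real l * of_int n * of_real \<kappa>))"
      by (simp add: norm_mult mult_left_mono)
  qed
  then show ?thesis by (auto simp: bounded_iff)
qed

text \<open>
  The definite description is justified here: two expansions of \<open>p\<close> have negative parts that both
  differ from \<open>p\<close> by a bounded function, so they coincide.
\<close>

lemma periodic_unbounded_part:
  assumes p: "p holomorphic_on right_halfplane 0" and per: "periodic_in \<kappa>\<^sub>0 p" "0 < \<kappa>\<^sub>0"
  obtains U where "vanishing_left U"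
    and "\<And>s. s \<in> right_halfplane 0 \<Longrightarrow> unbounded_part p s = U s"
    and "\<And>\<kappa>. 0 < \<kappa> \<Longrightarrow> bounded ((\<lambda>s. p s - U s) ` right_halfplane \<kappa>)"
proof -
  obtain l a where e: "exp_expansion p l a"
    using periodic_has_exp_expansion[OF assms] by blast
  obtain U where U: "vanishing_left U" "\<And>s. s \<in> right_halfplane 0 \<Longrightarrow>
           ((\<lambda>n. a n * exp (- of_real l * of_int n * s)) has_sum U s) {..<0}"
    by (rule exp_expansion_negative_part[OF e]) blast
  note bU = exp_expansion_minus_negative_part_bounded[OF e _ U(2)]
  have "unbounded_part p = restrict U (right_halfplane 0)"
    unfolding unbounded_part_def
  proof (rule the_equality)
    show "\<exists>l a. exp_expansion p l a \<and> restrict U (right_halfplane 0) =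
       (\<lambda>s\<in>right_halfplane 0. \<Sum>\<^sub>\<infinity>n\<in>{..<0}. a n * exp (- of_real l * of_int n * s))"
      using e infsumI[OF U(2)] by (intro exI conjI) (auto simp: fun_eq_iff restrict_def)
  next
    fix u assume "\<exists>l a. exp_expansion p l a \<and> u =
       (\<lambda>s\<in>right_halfplane 0. \<Sum>\<^sub>\<infinity>n\<in>{..<0}. a n * exp (- of_real l * of_int n * s))"
    then obtain l' a' where e': "exp_expansion p l' a'" and u: "u =
       (\<lambda>s\<in>right_halfplane 0. \<Sum>\<^sub>\<infinity>n\<in>{..<0}. a' n * exp (- of_real l' * of_int n * s))"
      by blast
    obtain V where V: "vanishing_left V" "\<And>s. s \<in> right_halfplane 0 \<Longrightarrow>
           ((\<lambda>n. a' n * exp (- of_real l' * of_int n * s)) has_sum V s) {..<0}"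
      by (rule exp_expansion_negative_part[OF e']) blast
    have "U s = V s" for s
      using vanishing_left_part_unique[OF U(1) bU[of 1] V(1)
          exp_expansion_minus_negative_part_bounded[OF e' _ V(2), of 1]] by simp
    then show "u = restrict U (right_halfplane 0)"
      using infsumI[OF V(2)] by (auto simp: fun_eq_iff restrict_def u)
  qed
  then show ?thesis
    using that U(1) bU by simp
qed

text \<open>
  All that is needed from a splitting: up to a function bounded on each smaller half-plane,
  \<open>f\<close> is the unbounded part of \<open>p\<close>, because both \<open>b\<close> and the rest of \<open>p\<close> are bounded there.
\<close>

lemma splitting_unbounded_part:
  assumes "is_splitting f p b"
  obtains U where "vanishing_left U"
    and "\<And>s. s \<in> right_halfplane 0 \<Longrightarrow> unbounded_part p s = U s"
    and "\<And>\<kappa>. 0 < \<kappa> \<Longrightarrow> bounded ((\<lambda>s. f s - U s) ` right_halfplane \<kappa>)"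
proof -
  note spl = assms[unfolded is_splitting_def]
  have "p analytic_on {s}" if "s \<in> right_halfplane 0" for s
  proof (rule analytic_on_subset)
    show "p analytic_on right_halfplane (Re s / 2)"
    proof -
      have "Re s / 2 > 0" using that by (simp add: right_halfplane_def)
      then show ?thesis using spl by blast
    qed
    show "{s} \<subseteq> right_halfplane (Re s / 2)"
      using that by (simp add: right_halfplane_def)
  qed
  then have "p holomorphic_on right_halfplane 0"
    using analytic_imp_holomorphic analytic_on_analytic_at by blast
  moreover have "periodic_in 1 p" using spl by simp
  ultimately obtain U where U: "vanishing_left U"
    "\<And>s. s \<in> right_halfplane 0 \<Longrightarrow> unbounded_part p s = U s"
    "\<And>\<kappa>. 0 < \<kappa> \<Longrightarrow> bounded ((\<lambda>s. p s - U s) ` right_halfplane \<kappa>)"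
    using periodic_unbounded_part[of p 1] by (metis zero_less_one)
  have "bounded ((\<lambda>s. f s - U s) ` right_halfplane \<kappa>)" if "0 < \<kappa>" for \<kappa>
  proof -
    have "bounded ((\<lambda>s. (p s - U s) + b s) ` right_halfplane \<kappa>)"
      using spl that by (intro bounded_plus_comp U(3)) auto
    also have "(\<lambda>s. (p s - U s) + b s) ` right_halfplane \<kappa> = (\<lambda>s. f s - U s) ` right_halfplane \<kappa>"
      using spl that by (intro image_cong) (auto simp: right_halfplane_def)
    finally show ?thesis .
  qed
  with U(1,2) show ?thesis using that by blast
qed

section \<open>The translation module as a group of periods\<close>

lemma translation_module_iff_bounded:
  "\<tau> \<in> translation_module \<kappa> f \<longleftrightarrow> bounded ((\<lambda>s. vtrans \<tau> f s - f s) ` right_halfplane \<kappa>)"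
  by (auto simp: translation_module_def translation_numbers_def bounded_pos)

text \<open>
  A summand bounded on the half-plane, such as \<open>f - U\<close>, does not affect whether translation differences are bounded,
  and a bounded translation difference of \<open>U\<close> must vanish.
\<close>

lemma translation_module_eq_periods:
  assumes U: "vanishing_left U" and h: "bounded ((\<lambda>s. f s - U s) ` right_halfplane \<kappa>)"
  shows "\<tau> \<in> translation_module \<kappa> f \<longleftrightarrow> (\<forall>s. vtrans \<tau> U s = U s)"
proof -
  have "bounded ((\<lambda>s. vtrans \<tau> f s - vtrans \<tau> U s) ` right_halfplane \<kappa>)"
  proof (intro bounded_subset[OF h] image_subsetI)
    fix s assume "s \<in> right_halfplane \<kappa>"
    then show "vtrans \<tau> f s - vtrans \<tau> U s \<in> (\<lambda>s. f s - U s) ` right_halfplane \<kappa>"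
      by (intro image_eqI[of _ _ "s + \<i> * of_real \<tau>"]) (simp_all add: vtrans_def)
  qed
  then have h2: "bounded ((\<lambda>s. (vtrans \<tau> f s - vtrans \<tau> U s) - (f s - U s)) ` right_halfplane \<kappa>)"
    using h by (rule bounded_minus_comp)
  show ?thesis
    unfolding translation_module_iff_bounded
  proof
    assume "bounded ((\<lambda>s. vtrans \<tau> f s - f s) ` right_halfplane \<kappa>)"
    from bounded_minus_comp[OF this h2]
    have "bounded ((\<lambda>s. vtrans \<tau> U s - U s) ` right_halfplane \<kappa>)"
      by (simp add: algebra_simps)
    from vanishing_left_bounded_right_imp_zero[OF vanishing_left_diff[OF vanishing_left_vtrans[OF U] U] this]
    show "\<forall>s. vtrans \<tau> U s = U s" by simp
  next
    assume "\<forall>s. vtrans \<tau> U s = U s"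
    with h2 show "bounded ((\<lambda>s. vtrans \<tau> f s - f s) ` right_halfplane \<kappa>)" by simp
  qed
qed

text \<open>
  Division with remainder: subtracting the largest integer multiple of \<open>t\<close> that does not exceed a
  period leaves a nonnegative period less than \<open>t\<close>, which minimality of \<open>t\<close> forces to be \<open>0\<close>.
\<close>

lemma periods_eq_multiples_of_least:
  assumes t: "t > 0" "\<And>s. vtrans t U s = U s"
    and least: "\<And>\<tau>. 0 < \<tau> \<Longrightarrow> (\<And>s. vtrans \<tau> U s = U s) \<Longrightarrow> t \<le> \<tau>"
  shows "{\<tau>. \<forall>s. vtrans \<tau> U s = U s} = {t * of_int k |k::int. True}"
proof -
  have mult: "vtrans (t * of_int k) U s = U s" for k s
    by (rule vtrans_period_int_multiple[of "Re s - 1"]) (simp_all add: t right_halfplane_def)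
  have "\<exists>k::int. \<tau> = t * of_int k" if \<tau>: "\<forall>s. vtrans \<tau> U s = U s" for \<tau>
  proof -
    define k where "k = \<lfloor>\<tau> / t\<rfloor>"
    define r where "r = \<tau> - t * of_int k"
    have "of_int k \<le> \<tau> / t" "\<tau> / t < of_int k + 1"
      unfolding k_def by linarith+
    then have r: "0 \<le> r" "r < t"
      using t(1) by (auto simp: r_def field_simps)
    have "vtrans r U s = U s" for s
    proof -
      have "vtrans r U s = vtrans (t * of_int k) U (s + \<i> * of_real r)"
        unfolding mult by (simp add: vtrans_def)
      also have "\<dots> = vtrans \<tau> U s"
        by (simp add: vtrans_def r_def algebra_simps)
      finally show ?thesis using \<tau> by simp
    qed
    then have "r = 0" using least[of r] r by fastforce
    then show ?thesis by (auto simp: r_def)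
  qed
  with mult show ?thesis by auto
qed

section \<open>Splittings of almost periodic functions\<close>

theorem theorem2:
  fixes f :: "complex \<Rightarrow> complex"
  assumes "\<And>\<kappa>::real. \<kappa> > 0 \<Longrightarrow> \<not> bounded (f ` right_halfplane \<kappa>)"
    and "\<And>\<kappa>::real. \<kappa> > 0 \<Longrightarrow> f analytic_on right_halfplane \<kappa>"
    and "\<And>\<kappa>::real. \<kappa> > 0 \<Longrightarrow> almost_periodic_in \<kappa> f"
  shows "(\<forall>p b t. is_splitting f p b \<and> t > 0 \<and> is_period_in 0 (unbounded_part p) t \<longrightarrow>
            (\<forall>\<kappa>>0. translation_module \<kappa> f = {t * of_int k |k::int. True})) \<and>
         (\<forall>p\<^sub>1 b\<^sub>1 p\<^sub>2 b\<^sub>2. is_splitting f p\<^sub>1 b\<^sub>1 \<and> is_splitting f p\<^sub>2 b\<^sub>2 \<longrightarrow>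
            (\<forall>s\<in>right_halfplane 0. unbounded_part p\<^sub>1 s = unbounded_part p\<^sub>2 s))"
proof (intro conjI allI impI ballI; elim conjE)
  fix p b t \<kappa>
  assume spl: "is_splitting f p b" and t: "is_period_in 0 (unbounded_part p) t" and \<kappa>: "(0::real) < \<kappa>"
  obtain U where U: "vanishing_left U"
    and pU: "\<And>s. s \<in> right_halfplane 0 \<Longrightarrow> unbounded_part p s = U s"
    and fU: "bounded ((\<lambda>s. f s - U s) ` right_halfplane \<kappa>)"
    using splitting_unbounded_part[OF spl] \<kappa> by metis
  have per: "(\<forall>s\<in>right_halfplane 0. vtrans \<tau> (unbounded_part p) s = unbounded_part p s) \<longleftrightarrow>
      (\<forall>s. vtrans \<tau> U s = U s)" for \<tau>
    using vanishing_left_period_extends[OF U, of 0 \<tau>] by (auto simp: vtrans_def pU)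
  have "{\<tau>. \<forall>s. vtrans \<tau> U s = U s} = {t * of_int k |k::int. True}"
    using t unfolding is_period_in_def per by (intro periods_eq_multiples_of_least) auto
  then show "translation_module \<kappa> f = {t * of_int k |k::int. True}"
    using translation_module_eq_periods[OF U fU] by blast
next
  fix p\<^sub>1 b\<^sub>1 p\<^sub>2 b\<^sub>2 s
  assume spl: "is_splitting f p\<^sub>1 b\<^sub>1" "is_splitting f p\<^sub>2 b\<^sub>2" and s: "s \<in> right_halfplane 0"
  obtain U\<^sub>1 where U1: "vanishing_left U\<^sub>1" "unbounded_part p\<^sub>1 s = U\<^sub>1 s"
      "bounded ((\<lambda>s. f s - U\<^sub>1 s) ` right_halfplane 1)"
    using splitting_unbounded_part[OF spl(1)] s by (metis zero_less_one)
  obtain U\<^sub>2 where U2: "vanishing_left U\<^sub>2" "unbounded_part p\<^sub>2 s = U\<^sub>2 s"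
      "bounded ((\<lambda>s. f s - U\<^sub>2 s) ` right_halfplane 1)"
    using splitting_unbounded_part[OF spl(2)] s by (metis zero_less_one)
  show "unbounded_part p\<^sub>1 s = unbounded_part p\<^sub>2 s"
    using vanishing_left_part_unique[OF U1(1,3) U2(1,3)] U1(2) U2(2) by simp
qed

end
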